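(* Consider linear stochastic bandits with action set $\mathcal X=\{x\in\mathbb R^d\mid \|x\|_\infty\le 1\}$, $d\ge 2$, whose expected reward function $f(x)=\langle x,\theta_\star\rangle$ is invariant under the action of some (hidden) subgroup $\mathcal G\le\mathcal S_d$ with $\dim(\mathrm{Fix}_{\mathcal G})=2$. Then the regret of any bandit algorithm is $\Omega(d\sqrt T)$. That is, there is a constant $c>0$ depending only on the noise level $\sigma$ such that for all $d\ge2$, all $T\ge 1$ and every bandit algorithm, there exist a subgroup $\mathcal G\le \mathcal S_d$ with $\dim(\mathrm{Fix}_{\mathcal G})=2$ and a parameter $\theta_\star\in\mathrm{Fix}_{\mathcal G}$ for which $$\mathbf R_T\ \ge\ c\,d\sqrt T .$$
   Context: Linear stochastic bandit: in each round $t=1,\dots,T$ ($T$ known in advance) the learner chooses an arm $x_t\in\mathcal X\subset\mathbb R^d$ and observes $y_t=\langle x_t,\theta_\star\rangle+\eta_t$, where $\theta_\star\in\mathbb R^d$ is unknown and the $\eta_t$ are i.i.d. $N(0,\sigma^2)$ with $\sigma>0$. A bandit algorithm is a (possibly randomized) rule choosing the distribution of $x_t$ as a function of the past observations $(x_s,y_s)_{s<t}$. The expected regret is $\mathbf R_T=\mathbb E\big[\sum_{t=1}^T\langle x_\star-x_t,\theta_\star\rangle\big]$ with $x_\star\in\arg\max_{x\in\mathcal X}\langle x,\theta_\star\rangle$. $\mathcal S_d$ is the group of bijections of $[d]$, acting on $\mathbb R^d$ by $g\cdot x=(x_{g(i)})_{i\in[d]}$. For $\mathcal G\le\mathcal S_d$,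 $\mathrm{Fix}_{\mathcal G}=\{x\in\mathbb R^d\mid g\cdot x=x\ \forall g\in\mathcal G\}$. Invariance of $f$ under $\mathcal G$ means $f(g\cdot x)=f(x)$ for all $g\in\mathcal G$, equivalently $\theta_\star\in\mathrm{Fix}_{\mathcal G}$. The subgroup $\mathcal G$ is not revealed to the learner. *)

theory Defs
  imports
    "HOL-Probability.Probability"
    "HOL-Algebra.Sym_Groups"
    "HOL-Library.Function_Algebras"
begin

(* The dimension d is quantified inside the statement, so R^d is the set of functions on nat
   that vanish outside {1..d}; this is a linear subspace of nat => real, and the index set is
   the one on which sym_group d acts. *)
definition euclidean :: "nat \<Rightarrow> (nat \<Rightarrow> real) set" where
  "euclidean d = {x. \<forall>i. i \<notin> {1..d} \<longrightarrow> x i = 0}"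

definition dot :: "nat \<Rightarrow> (nat \<Rightarrow> real) \<Rightarrow> (nat \<Rightarrow> real) \<Rightarrow> real" where
  "dot d x y = (\<Sum>i\<in>{1..d}. x i * y i)"

definition norm_inf :: "nat \<Rightarrow> (nat \<Rightarrow> real) \<Rightarrow> real" where
  "norm_inf d x = Max ((\<lambda>i. \<bar>x i\<bar>) ` {1..d})"

interpretation fun_vs: vector_space "\<lambda>(c::real) (x::nat \<Rightarrow> real) i. c * x i"
  by unfold_locales (auto simp: fun_eq_iff algebra_simps)

definition perm_act :: "(nat \<Rightarrow> nat) \<Rightarrow> (nat \<Rightarrow> real) \<Rightarrow> (nat \<Rightarrow> real)" where
  "perm_act g x = (\<lambda>i. x (g i))"

definition Fix :: "nat \<Rightarrow> (nat \<Rightarrow> nat) set \<Rightarrow> (nat \<Rightarrow> real) set" where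
  "Fix d G = {x \<in> euclidean d. \<forall>g\<in>G. perm_act g x = x}"

definition arms :: "nat \<Rightarrow> (nat \<Rightarrow> real) set" where
  "arms d = {x \<in> euclidean d. norm_inf d x \<le> 1}"

(* The trace of the product topology on nat => real is the Euclidean topology of R^d. *)
definition arm_space :: "nat \<Rightarrow> (nat \<Rightarrow> real) measure" where
  "arm_space d = restrict_space borel (arms d)"

type_synonym history = "nat \<Rightarrow> (nat \<Rightarrow> real) \<times> real"

(* Sequences (x_s, y_s), s = 1..n, of arms and observations. *)
definition history_space :: "nat \<Rightarrow> nat \<Rightarrow> history measure" where
  "history_space d n = (\<Pi>\<^sub>M s\<in>{1..n}. arm_space d \<Otimes>\<^sub>M borel)"

(* In round Suc n the arm is drawn from a probability kernel applied to the first n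
   observations. *)
definition bandit_algorithm ::
  "nat \<Rightarrow> nat \<Rightarrow> (nat \<Rightarrow> history \<Rightarrow> (nat \<Rightarrow> real) measure) \<Rightarrow> bool" where
  "bandit_algorithm d T \<pi> \<longleftrightarrow>
     (\<forall>n<T. \<pi> (Suc n) \<in> history_space d n \<rightarrow>\<^sub>M prob_algebra (arm_space d))"

(* Joint law of (x_1, y_1), ..., (x_n, y_n). The noise of each round is drawn independently of
   the past and of the chosen arm. *)
primrec history_law ::
  "nat \<Rightarrow> real \<Rightarrow> (nat \<Rightarrow> real) \<Rightarrow> (nat \<Rightarrow> history \<Rightarrow> (nat \<Rightarrow> real) measure) \<Rightarrow> nat
    \<Rightarrow> history measure" where
  "history_law d \<sigma> \<theta> \<pi> 0 = return (history_space d 0) (\<lambda>_. undefined)"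
| "history_law d \<sigma> \<theta> \<pi> (Suc n) =
     do {
       h \<leftarrow> history_law d \<sigma> \<theta> \<pi> n;
       x \<leftarrow> \<pi> (Suc n) h;
       \<eta> \<leftarrow> density lborel (normal_density 0 \<sigma>);
       return (history_space d (Suc n)) (h(Suc n := (x, dot d x \<theta> + \<eta>)))
     }"

(* The maximum over the cube is attained, and the value of dot at a maximiser does not depend on
   which one is chosen. *)
definition best_arm :: "nat \<Rightarrow> (nat \<Rightarrow> real) \<Rightarrow> (nat \<Rightarrow> real)" where
  "best_arm d \<theta> = (ARG_MAX (\<lambda>x. dot d x \<theta>) x. x \<in> arms d)"

definition regret ::
  "nat \<Rightarrow> real \<Rightarrow> (nat \<Rightarrow> real) \<Rightarrow> (nat \<Rightarrow> history \<Rightarrow> (nat \<Rightarrow> real) measure) \<Rightarrow> nat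
    \<Rightarrow> real" where
  "regret d \<sigma> \<theta> \<pi> T =
     (\<integral>h. (\<Sum>t\<in>{1..T}. dot d (best_arm d \<theta> - fst (h t)) \<theta>) \<partial>history_law d \<sigma> \<theta> \<pi> T)"

end

theory Submission
  imports Defs
begin

text \<open>Take \<open>\<theta> = \<epsilon> s\<close> with \<open>s\<close> a vertex of the cube and \<open>\<epsilon> = \<sigma> / (2 \<surd>T)\<close>. The level sets of \<open>s\<close> form
  at most two blocks, so \<open>\<theta>\<close> is fixed by the stabiliser of a partition of the indices into two
  nonempty blocks (any such partition if \<open>s\<close> is constant). Flipping one coordinate of \<open>s\<close> moves every
  mean reward by at most \<open>2 \<epsilon>\<close>, and a chi-square bound, propagated through the rounds by
  Cauchy--Schwarz, gives \<open>(\<integral>f dQ)\<^sup>2 \<le> e \<integral>f\<^sup>2 dP\<close> for the two laws of the whole history. Hence no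
  algorithm has small regret in that coordinate under both signs, and averaging over all \<open>s\<close>
  gives one vertex that is bad in a constant fraction of the coordinates.\<close>

section \<open>Gaussian shifts\<close>

text \<open>Cauchy-Schwarz against the constant 1, whose integral is 1. It moves the square inside
  the average over the arm drawn in a round.\<close>

lemma square_nn_integral_le:
  assumes "prob_space M" and [measurable]: "f \<in> borel_measurable M"
  shows "(\<integral>\<^sup>+x. f x \<partial>M)\<^sup>2 \<le> (\<integral>\<^sup>+x. (f x)\<^sup>2 \<partial>M)"
proof -
  interpret prob_space M by fact
  show ?thesis
    using Cauchy_Schwarz_nn_integral[of f M "\<lambda>_. 1"] by (simp add: emeasure_space_1)
qed

text \<open>With \<open>p\<close> and \<open>q\<close> the normal densities of means \<mu> and
  \<nu>, this is \<open>q^2 / p\<close>, the integrand of one plus the chi-square divergence.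
  Completing the square in the exponents recentres it at \<open>2 * \<nu> - \<mu>\<close>, so it
  integrates to the exponential factor.\<close>

lemma normal_density_chi_square:
  assumes "\<sigma> > 0"
  shows "(normal_density \<nu> \<sigma> y / sqrt (normal_density \<mu> \<sigma> y))\<^sup>2
           = exp ((\<nu> - \<mu>)\<^sup>2 / \<sigma>\<^sup>2) * normal_density (2 * \<nu> - \<mu>) \<sigma> y"
proof -
  have pos: "normal_density \<mu> \<sigma> y > 0"
    using assms by (rule normal_density_pos)
  have "- (y - \<nu>)\<^sup>2 / (2 * \<sigma>\<^sup>2) + - (y - \<nu>)\<^sup>2 / (2 * \<sigma>\<^sup>2)
      = - (y - \<mu>)\<^sup>2 / (2 * \<sigma>\<^sup>2) + ((\<nu> - \<mu>)\<^sup>2 / \<sigma>\<^sup>2 + - (y - (2 * \<nu> - \<mu>))\<^sup>2 / (2 * \<sigma>\<^sup>2))"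
    using assms by (simp add: field_simps power2_eq_square)
  then have "exp (- (y - \<nu>)\<^sup>2 / (2 * \<sigma>\<^sup>2)) * exp (- (y - \<nu>)\<^sup>2 / (2 * \<sigma>\<^sup>2))
      = exp (- (y - \<mu>)\<^sup>2 / (2 * \<sigma>\<^sup>2))
        * (exp ((\<nu> - \<mu>)\<^sup>2 / \<sigma>\<^sup>2) * exp (- (y - (2 * \<nu> - \<mu>))\<^sup>2 / (2 * \<sigma>\<^sup>2)))"
    unfolding exp_add[symmetric] by simp
  then have "(normal_density \<nu> \<sigma> y)\<^sup>2
      = normal_density \<mu> \<sigma> y * (exp ((\<nu> - \<mu>)\<^sup>2 / \<sigma>\<^sup>2) * normal_density (2 * \<nu> - \<mu>) \<sigma> y)"
    by (simp add: normal_density_def power2_eq_square)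
  with pos show ?thesis
    by (simp add: power_divide field_simps)
qed

text \<open>Substituting \<open>y = \<mu> + \<eta>\<close> moves the mean from the integrand into
  the density, so that two means can be compared over Lebesgue measure.\<close>

lemma nn_integral_normal_shift:
  fixes f :: "real \<Rightarrow> ennreal"
  assumes [measurable]: "f \<in> borel_measurable borel"
  shows "(\<integral>\<^sup>+\<eta>. f (\<mu> + \<eta>) \<partial>density lborel (normal_density 0 \<sigma>))
           = (\<integral>\<^sup>+y. normal_density \<mu> \<sigma> y * f y \<partial>lborel)"
proof -
  have "(\<integral>\<^sup>+\<eta>. f (\<mu> + \<eta>) \<partial>density lborel (normal_density 0 \<sigma>))
      = (\<integral>\<^sup>+\<eta>. normal_density \<mu> \<sigma> (\<mu> + \<eta>) * f (\<mu> + \<eta>) \<partial>lborel)"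
    by (subst nn_integral_density) (auto simp: normal_density_def)
  also have "\<dots> = (\<integral>\<^sup>+y. normal_density \<mu> \<sigma> y * f y \<partial>lborel)"
    by (subst nn_integral_real_affine[where c = 1 and t = \<mu>]) auto
  finally show ?thesis .
qed

text \<open>Write \<open>q\<close> as \<open>sqrt p\<close> times \<open>q / sqrt p\<close> and
  apply Cauchy-Schwarz with \<open>f\<close> attached to the first factor. This leaves the second
  moment of \<open>f\<close> under \<open>p\<close> and the integral of \<open>q^2 / p\<close>,
  which is the constant.\<close>

lemma normal_shift_square_le:
  fixes f :: "real \<Rightarrow> ennreal"
  assumes "\<sigma> > 0" and [measurable]: "f \<in> borel_measurable borel"
  shows "(\<integral>\<^sup>+\<eta>. f (\<nu> + \<eta>) \<partial>density lborel (normal_density 0 \<sigma>))\<^sup>2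
           \<le> ennreal (exp ((\<nu> - \<mu>)\<^sup>2 / \<sigma>\<^sup>2))
             * (\<integral>\<^sup>+\<eta>. (f (\<mu> + \<eta>))\<^sup>2 \<partial>density lborel (normal_density 0 \<sigma>))"
proof -
  define p where "p = normal_density \<mu> \<sigma>"
  define q where "q = normal_density \<nu> \<sigma>"
  have [measurable]: "p \<in> borel_measurable borel" "q \<in> borel_measurable borel"
    by (simp_all add: p_def q_def)
  have pos: "p y > 0" "q y > 0" for y
    using assms by (simp_all add: p_def q_def normal_density_pos)
  have split: "ennreal (q y) = ennreal (sqrt (p y)) * ennreal (q y / sqrt (p y))" for y
    using pos[of y] by (subst ennreal_mult[symmetric]) (auto simp: less_imp_le)
  have "(\<integral>\<^sup>+y. q y * f y \<partial>lborel)\<^sup>2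
      = (\<integral>\<^sup>+y. (ennreal (sqrt (p y)) * f y) * ennreal (q y / sqrt (p y)) \<partial>lborel)\<^sup>2"
    by (simp add: split mult_ac)
  also have "\<dots> \<le> (\<integral>\<^sup>+y. (ennreal (sqrt (p y)) * f y)\<^sup>2 \<partial>lborel)
                * (\<integral>\<^sup>+y. (ennreal (q y / sqrt (p y)))\<^sup>2 \<partial>lborel)"
    by (intro Cauchy_Schwarz_nn_integral) measurable
  also have "(\<integral>\<^sup>+y. (ennreal (sqrt (p y)) * f y)\<^sup>2 \<partial>lborel) = (\<integral>\<^sup>+y. p y * (f y)\<^sup>2 \<partial>lborel)"
    using pos by (simp add: power_mult_distrib ennreal_power less_imp_le)
  also have "(\<integral>\<^sup>+y. (ennreal (q y / sqrt (p y)))\<^sup>2 \<partial>lborel)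
      = (\<integral>\<^sup>+y. exp ((\<nu> - \<mu>)\<^sup>2 / \<sigma>\<^sup>2) * ennreal (normal_density (2 * \<nu> - \<mu>) \<sigma> y) \<partial>lborel)"
  proof (rule nn_integral_cong)
    fix y
    show "(ennreal (q y / sqrt (p y)))\<^sup>2
        = ennreal (exp ((\<nu> - \<mu>)\<^sup>2 / \<sigma>\<^sup>2)) * ennreal (normal_density (2 * \<nu> - \<mu>) \<sigma> y)"
      using pos[of y] assms(1) normal_density_chi_square[OF assms(1), of \<nu> y \<mu>]
      by (simp add: ennreal_power less_imp_le p_def q_def ennreal_mult[symmetric])
  qed
  also have "\<dots> = exp ((\<nu> - \<mu>)\<^sup>2 / \<sigma>\<^sup>2)"
    using assms(1)
    by (simp add: nn_integral_cmult nn_integral_eq_integral normal_density_nonneg)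
  finally show ?thesis
    using nn_integral_normal_shift[of f \<sigma> \<nu>] nn_integral_normal_shift[of "\<lambda>y. (f y)\<^sup>2" \<sigma> \<mu>]
    by (simp add: p_def q_def mult.commute)
qed

section \<open>Laws of histories\<close>

lemma dot_measurable [measurable]: "(\<lambda>x. dot d x \<theta>) \<in> borel_measurable (arm_space d)"
  unfolding dot_def arm_space_def by (intro measurable_restrict_space1) measurable

lemma coordinate_measurable [measurable]: "(\<lambda>x. x i) \<in> borel_measurable (arm_space d)"
  unfolding arm_space_def by (intro measurable_restrict_space1) measurable

lemma space_arm_space: "space (arm_space d) = arms d"
  by (simp add: arm_space_def space_restrict_space)

lemma arms_abs_le:
  assumes "x \<in> arms d" "i \<in> {1..d}"
  shows "\<bar>x i\<bar> \<le> 1"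
proof -
  have "\<bar>x i\<bar> \<le> norm_inf d x"
    unfolding norm_inf_def using assms by (intro Max_ge) auto
  with assms show ?thesis by (simp add: arms_def)
qed

lemma history_arm_in_arms:
  assumes "h \<in> space (history_space d n)" "t \<in> {1..n}"
  shows "fst (h t) \<in> arms d"
  using assms
  by (auto simp: history_space_def space_PiM space_pair_measure space_arm_space PiE_iff mem_Times_iff)

lemma history_arm_measurable [measurable]:
  "t \<in> {1..n} \<Longrightarrow> (\<lambda>h. fst (h t)) \<in> history_space d n \<rightarrow>\<^sub>M arm_space d"
  unfolding history_space_def by measurable

text \<open>The update enlarges the index set from \<open>{1..n}\<close> to
  \<open>{1..Suc n}\<close>, so measurability is checked coordinate by coordinate: the last one
  comes from \<open>g\<close>, the earlier ones from \<open>f\<close>.\<close>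

lemma history_update_measurable [measurable]:
  assumes [measurable]: "f \<in> M \<rightarrow>\<^sub>M history_space d n"
    "g \<in> M \<rightarrow>\<^sub>M arm_space d \<Otimes>\<^sub>M borel"
  shows "(\<lambda>z. (f z)(Suc n := g z)) \<in> M \<rightarrow>\<^sub>M history_space d (Suc n)"
  unfolding history_space_def
proof (rule measurable_PiM_single')
  fix i assume i: "i \<in> {1..Suc n}"
  show "(\<lambda>z. ((f z)(Suc n := g z)) i) \<in> M \<rightarrow>\<^sub>M arm_space d \<Otimes>\<^sub>M borel"
  proof (cases "i = Suc n")
    case False
    with i have "i \<in> {1..n}" by auto
    then have "(\<lambda>h. h i) \<in> history_space d n \<rightarrow>\<^sub>M arm_space d \<Otimes>\<^sub>M borel"
      unfolding history_space_def by measurable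
    from measurable_compose[OF assms(1) this] False show ?thesis by simp
  qed simp
next
  show "(\<lambda>z. (f z)(Suc n := g z)) \<in> space M \<rightarrow> {1..Suc n} \<rightarrow>\<^sub>E space (arm_space d \<Otimes>\<^sub>M borel)"
    using measurable_space[OF assms(1)] measurable_space[OF assms(2)]
    by (auto simp: history_space_def space_PiM PiE_iff extensional_def le_Suc_eq)
qed

section \<open>One round as a Markov kernel\<close>

definition round_kernel ::
  "nat \<Rightarrow> real \<Rightarrow> (nat \<Rightarrow> real) \<Rightarrow> (nat \<Rightarrow> history \<Rightarrow> (nat \<Rightarrow> real) measure) \<Rightarrow> nat
    \<Rightarrow> history \<Rightarrow> history measure" where
  "round_kernel d \<sigma> \<theta> \<pi> n h =
     do {
       x \<leftarrow> \<pi> (Suc n) h;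
       \<eta> \<leftarrow> density lborel (normal_density 0 \<sigma>);
       return (history_space d (Suc n)) (h(Suc n := (x, dot d x \<theta> + \<eta>)))
     }"

text \<open>With the inner binds collected in one kernel, the history is a chain of kernels, and an
  integral over it can be peeled off one round at a time.\<close>

lemma history_law_Suc:
  "history_law d \<sigma> \<theta> \<pi> (Suc n) = history_law d \<sigma> \<theta> \<pi> n \<bind> round_kernel d \<sigma> \<theta> \<pi> n"
  by (simp add: round_kernel_def[abs_def])

context
  fixes d T :: nat and \<sigma> :: real and \<pi> :: "nat \<Rightarrow> history \<Rightarrow> (nat \<Rightarrow> real) measure"
  assumes sigma: "\<sigma> > 0" and bandit: "bandit_algorithm d T \<pi>"
begin

abbreviation "noise \<equiv> density lborel (normal_density 0 \<sigma>)"

lemma policy_measurable: "n < T \<Longrightarrow> \<pi> (Suc n) \<in> history_space d n \<rightarrow>\<^sub>M prob_algebra (arm_space d)"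
  using bandit by (simp add: bandit_algorithm_def)

lemma noise_in_prob_algebra: "noise \<in> space (prob_algebra borel)"
  using prob_space_normal_density[OF sigma, of 0] by (simp add: space_prob_algebra)

text \<open>Measurability jointly in history and arm is what the bind over the history-dependent
  policy requires.\<close>

lemma noise_kernel_measurable:
  "(\<lambda>(h, x). noise \<bind> (\<lambda>\<eta>. return (history_space d (Suc n)) (h(Suc n := (x, dot d x \<theta> + \<eta>)))))
     \<in> history_space d n \<Otimes>\<^sub>M arm_space d \<rightarrow>\<^sub>M prob_algebra (history_space d (Suc n))"
  unfolding split_beta
proof (rule measurable_bind_prob_space2)
  show "(\<lambda>_. noise) \<in> history_space d n \<Otimes>\<^sub>M arm_space d \<rightarrow>\<^sub>M prob_algebra borel"
    by (rule measurable_const[OF noise_in_prob_algebra])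
  show "(\<lambda>(z, \<eta>). return (history_space d (Suc n))
          ((fst z)(Suc n := (snd z, dot d (snd z) \<theta> + \<eta>))))
      \<in> (history_space d n \<Otimes>\<^sub>M arm_space d) \<Otimes>\<^sub>M borel \<rightarrow>\<^sub>M prob_algebra (history_space d (Suc n))"
    unfolding split_beta
    by (rule measurable_compose[OF _ measurable_return_prob_space]) measurable
qed

lemma round_kernel_measurable:
  assumes "n < T"
  shows "round_kernel d \<sigma> \<theta> \<pi> n
           \<in> history_space d n \<rightarrow>\<^sub>M prob_algebra (history_space d (Suc n))"
  unfolding round_kernel_def
  by (rule measurable_bind_prob_space2[OF policy_measurable[OF assms] noise_kernel_measurable])

lemma history_law_in_prob_algebra:
  "n \<le> T \<Longrightarrow> history_law d \<sigma> \<theta> \<pi> n \<in> space (prob_algebra (history_space d n))"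
proof (induction n)
  case 0
  then show ?case
    by (auto simp: space_prob_algebra history_space_def space_PiM intro!: prob_space_return)
next
  case (Suc n)
  then show ?case
    \<comment> \<open>The bind rule speaks of a measurable family of measures. The law of the past
      enters as a constant family over the dummy space \<open>count_space UNIV\<close>, evaluated at
      \<open>undefined\<close>.\<close>
    using measurable_space[OF measurable_bind_prob_space[OF measurable_const
        round_kernel_measurable[of n \<theta>]], of _ undefined "count_space UNIV"]
    by (simp add: history_law_Suc del: history_law.simps(2))
qed

lemma prob_space_history_law: "n \<le> T \<Longrightarrow> prob_space (history_law d \<sigma> \<theta> \<pi> n)"
  and sets_history_law: "n \<le> T \<Longrightarrow> sets (history_law d \<sigma> \<theta> \<pi> n) = sets (history_space d n)"
  using history_law_in_prob_algebra by (auto simp: space_prob_algebra)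

lemma measurable_history_law:
  "n \<le> T \<Longrightarrow> measurable (history_law d \<sigma> \<theta> \<pi> n) N = measurable (history_space d n) N"
  by (intro measurable_cong_sets sets_history_law) auto

lemma space_history_law: "n \<le> T \<Longrightarrow> space (history_law d \<sigma> \<theta> \<pi> n) = space (history_space d n)"
  by (intro sets_eq_imp_space_eq sets_history_law)

lemma nn_integral_round_kernel:
  assumes "n < T" and h: "h \<in> space (history_space d n)"
    and [measurable]: "f \<in> borel_measurable (history_space d (Suc n))"
  shows "(\<integral>\<^sup>+z. f z \<partial>round_kernel d \<sigma> \<theta> \<pi> n h)
           = (\<integral>\<^sup>+x. \<integral>\<^sup>+\<eta>. f (h(Suc n := (x, dot d x \<theta> + \<eta>))) \<partial>noise \<partial>\<pi> (Suc n) h)"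
proof -
  have policy: "sets (\<pi> (Suc n) h) = sets (arm_space d)"
    using measurable_space[OF policy_measurable[OF assms(1)] h] by (simp add: space_prob_algebra)
  then have space: "space (\<pi> (Suc n) h) = space (arm_space d)"
    by (rule sets_eq_imp_space_eq)
  have update [measurable]: "(\<lambda>\<eta>. h(Suc n := (x, dot d x \<theta> + \<eta>))) \<in> borel \<rightarrow>\<^sub>M history_space d (Suc n)"
    if "x \<in> space (arm_space d)" for x
    using h that by measurable
  have "(\<lambda>x. noise \<bind> (\<lambda>\<eta>. return (history_space d (Suc n)) (h(Suc n := (x, dot d x \<theta> + \<eta>)))))
      \<in> arm_space d \<rightarrow>\<^sub>M prob_algebra (history_space d (Suc n))"
    using measurable_compose[OF measurable_Pair1'[OF h] noise_kernel_measurable] by simp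
  then have kernel:
    "(\<lambda>x. noise \<bind> (\<lambda>\<eta>. return (history_space d (Suc n)) (h(Suc n := (x, dot d x \<theta> + \<eta>)))))
      \<in> \<pi> (Suc n) h \<rightarrow>\<^sub>M subprob_algebra (history_space d (Suc n))"
    by (simp add: measurable_prob_algebraD measurable_cong_sets[OF policy refl])
  show ?thesis
    unfolding round_kernel_def nn_integral_bind[OF assms(3) kernel]
  proof (rule nn_integral_cong)
    fix x assume "x \<in> space (\<pi> (Suc n) h)"
    then have x: "x \<in> space (arm_space d)"
      using space by simp
    have "(\<lambda>\<eta>. return (history_space d (Suc n)) (h(Suc n := (x, dot d x \<theta> + \<eta>))))
        \<in> noise \<rightarrow>\<^sub>M subprob_algebra (history_space d (Suc n))"
      using measurable_compose[OF update[OF x] return_measurable] by simp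
    from nn_integral_bind[OF assms(3) this]
    show "(\<integral>\<^sup>+z. f z \<partial>(noise \<bind> (\<lambda>\<eta>. return (history_space d (Suc n))
            (h(Suc n := (x, dot d x \<theta> + \<eta>))))))
        = (\<integral>\<^sup>+\<eta>. f (h(Suc n := (x, dot d x \<theta> + \<eta>))) \<partial>noise)"
      using x by (subst (asm) nn_integral_return)
        (auto intro!: measurable_space[of "\<lambda>\<eta>. h(Suc n := (x, dot d x \<theta> + \<eta>))" borel])
  qed
qed

text \<open>The policy sees only \<open>h\<close>, so both parameters draw the arm from the same law
  and differ only in the mean of the observation. The square passes inside the average over arms,
  and the Gaussian bound is applied arm by arm, with \<delta> making its constant uniform.\<close>

lemma round_kernel_square_le:
  assumes "n < T" and h: "h \<in> space (history_space d n)"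
    and [measurable]: "f \<in> borel_measurable (history_space d (Suc n))"
    and close: "\<And>x. x \<in> arms d \<Longrightarrow> \<bar>dot d x \<theta>' - dot d x \<theta>\<bar> \<le> \<delta>"
  shows "(\<integral>\<^sup>+z. f z \<partial>round_kernel d \<sigma> \<theta>' \<pi> n h)\<^sup>2
           \<le> ennreal (exp (\<delta>\<^sup>2 / \<sigma>\<^sup>2)) * (\<integral>\<^sup>+z. (f z)\<^sup>2 \<partial>round_kernel d \<sigma> \<theta> \<pi> n h)"
proof -
  let ?M = "\<pi> (Suc n) h"
  let ?g = "\<lambda>\<theta> f x. \<integral>\<^sup>+\<eta>. f (h(Suc n := (x, dot d x \<theta> + \<eta>))) \<partial>noise"
  have M: "prob_space ?M" "sets ?M = sets (arm_space d)"
    using measurable_space[OF policy_measurable[OF assms(1)] h] by (auto simp: space_prob_algebra)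
  have space: "space ?M = arms d"
    using sets_eq_imp_space_eq[OF M(2)] by (simp add: space_arm_space)
  have sigma_finite: "sigma_finite_measure noise"
    using prob_space_normal_density[OF sigma, of 0]
    by (simp add: prob_space.axioms finite_measure_def prob_space_imp_sigma_finite)
  have g: "?g \<theta> f \<in> borel_measurable ?M"
    if [measurable]: "f \<in> borel_measurable (history_space d (Suc n))" for \<theta> and f :: "_ \<Rightarrow> ennreal"
  proof -
    have "?g \<theta> f \<in> borel_measurable (arm_space d)"
      using h by (intro sigma_finite_measure.borel_measurable_nn_integral[OF sigma_finite]) measurable
    then show ?thesis
      by (simp add: measurable_cong_sets[OF M(2) refl])
  qed
  have "(\<integral>\<^sup>+z. f z \<partial>round_kernel d \<sigma> \<theta>' \<pi> n h)\<^sup>2 = (\<integral>\<^sup>+x. ?g \<theta>' f x \<partial>?M)\<^sup>2"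
    by (simp add: nn_integral_round_kernel assms)
  also have "\<dots> \<le> (\<integral>\<^sup>+x. (?g \<theta>' f x)\<^sup>2 \<partial>?M)"
    by (intro square_nn_integral_le M g) measurable
  also have "\<dots> \<le> (\<integral>\<^sup>+x. ennreal (exp (\<delta>\<^sup>2 / \<sigma>\<^sup>2)) * ?g \<theta> (\<lambda>z. (f z)\<^sup>2) x \<partial>?M)"
  proof (rule nn_integral_mono)
    fix x assume "x \<in> space ?M"
    then have x: "x \<in> arms d"
      using space by simp
    then have "(\<lambda>y. h(Suc n := (x, y))) \<in> borel \<rightarrow>\<^sub>M history_space d (Suc n)"
      using h by (intro history_update_measurable) (auto simp: space_arm_space)
    then have [measurable]: "(\<lambda>y. f (h(Suc n := (x, y)))) \<in> borel_measurable borel"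
      by measurable
    have "\<bar>dot d x \<theta>' - dot d x \<theta>\<bar>\<^sup>2 \<le> \<delta>\<^sup>2"
      using close[OF x] by (intro power_mono) auto
    then have "exp ((dot d x \<theta>' - dot d x \<theta>)\<^sup>2 / \<sigma>\<^sup>2) \<le> exp (\<delta>\<^sup>2 / \<sigma>\<^sup>2)"
      by (simp add: divide_right_mono)
    then show "(?g \<theta>' f x)\<^sup>2 \<le> ennreal (exp (\<delta>\<^sup>2 / \<sigma>\<^sup>2)) * ?g \<theta> (\<lambda>z. (f z)\<^sup>2) x"
      by (intro order_trans[OF normal_shift_square_le[OF sigma,
            of "\<lambda>y. f (h(Suc n := (x, y)))" _ "dot d x \<theta>"]] mult_right_mono ennreal_leI)
        auto
  qed
  also have "\<dots> = ennreal (exp (\<delta>\<^sup>2 / \<sigma>\<^sup>2)) * (\<integral>\<^sup>+x. ?g \<theta> (\<lambda>z. (f z)\<^sup>2) x \<partial>?M)"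
    by (intro nn_integral_cmult g) measurable
  also have "(\<integral>\<^sup>+x. ?g \<theta> (\<lambda>z. (f z)\<^sup>2) x \<partial>?M) = (\<integral>\<^sup>+z. (f z)\<^sup>2 \<partial>round_kernel d \<sigma> \<theta> \<pi> n h)"
    using assms(1) h by (subst nn_integral_round_kernel) auto
  finally show ?thesis .
qed

text \<open>A square on the left against a second moment on the right is a form that iterates. The
  induction hypothesis, applied to the one-round average of \<open>f\<close> under
  \<open>\<theta>'\<close>, leaves the square of that average under the law for \<theta>. The
  one-round bound turns this into an average of the square of \<open>f\<close>, at the cost of one
  factor per round.\<close>

lemma history_law_square_le:
  assumes close: "\<And>x. x \<in> arms d \<Longrightarrow> \<bar>dot d x \<theta>' - dot d x \<theta>\<bar> \<le> \<delta>"
    and "n \<le> T" "f \<in> borel_measurable (history_space d n)"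
  shows "(\<integral>\<^sup>+h. f h \<partial>history_law d \<sigma> \<theta>' \<pi> n)\<^sup>2
           \<le> ennreal (exp (\<delta>\<^sup>2 / \<sigma>\<^sup>2)) ^ n * (\<integral>\<^sup>+h. (f h)\<^sup>2 \<partial>history_law d \<sigma> \<theta> \<pi> n)"
  using assms(2,3)
proof (induction n arbitrary: f)
  case 0
  have "(\<lambda>_. undefined) \<in> space (history_space d 0)"
    by (simp add: history_space_def space_PiM)
  with 0 show ?case
    by (simp add: nn_integral_return)
next
  case (Suc n)
  let ?C = "ennreal (exp (\<delta>\<^sup>2 / \<sigma>\<^sup>2))"
  let ?K = "\<lambda>\<theta>. round_kernel d \<sigma> \<theta> \<pi> n"
  have n: "n < T" "n \<le> T"
    using Suc.prems by auto
  note [measurable] = Suc.prems(2)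
  have K: "?K \<theta> \<in> history_space d n \<rightarrow>\<^sub>M subprob_algebra (history_space d (Suc n))" for \<theta>
    by (rule measurable_prob_algebraD[OF round_kernel_measurable[OF n(1)]])
  have g: "(\<lambda>h. \<integral>\<^sup>+z. f z \<partial>?K \<theta> h) \<in> borel_measurable (history_space d n)"
    if "f \<in> borel_measurable (history_space d (Suc n))" for \<theta> f
    by (rule measurable_compose[OF K nn_integral_measurable_subprob_algebra[OF that]])
  have bind: "(\<integral>\<^sup>+z. f z \<partial>history_law d \<sigma> \<theta> \<pi> (Suc n))
      = (\<integral>\<^sup>+h. \<integral>\<^sup>+z. f z \<partial>?K \<theta> h \<partial>history_law d \<sigma> \<theta> \<pi> n)"
    if "f \<in> borel_measurable (history_space d (Suc n))" for \<theta> f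
    unfolding history_law_Suc
    by (rule nn_integral_bind[OF that]) (simp add: measurable_history_law[OF n(2)] K)
  have "(\<integral>\<^sup>+z. f z \<partial>history_law d \<sigma> \<theta>' \<pi> (Suc n))\<^sup>2
      = (\<integral>\<^sup>+h. \<integral>\<^sup>+z. f z \<partial>?K \<theta>' h \<partial>history_law d \<sigma> \<theta>' \<pi> n)\<^sup>2"
    by (simp only: bind[OF Suc.prems(2)])
  also have "\<dots> \<le> ?C ^ n * (\<integral>\<^sup>+h. (\<integral>\<^sup>+z. f z \<partial>?K \<theta>' h)\<^sup>2 \<partial>history_law d \<sigma> \<theta> \<pi> n)"
    by (rule Suc.IH[OF n(2) g]) fact
  also have "\<dots> \<le> ?C ^ n * (\<integral>\<^sup>+h. ?C * (\<integral>\<^sup>+z. (f z)\<^sup>2 \<partial>?K \<theta> h) \<partial>history_law d \<sigma> \<theta> \<pi> n)"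
    by (intro mult_left_mono nn_integral_mono round_kernel_square_le n Suc.prems close)
      (auto simp: space_history_law n)
  also have "\<dots> = ?C ^ n * (?C * (\<integral>\<^sup>+h. \<integral>\<^sup>+z. (f z)\<^sup>2 \<partial>?K \<theta> h \<partial>history_law d \<sigma> \<theta> \<pi> n))"
    by (subst nn_integral_cmult) (auto simp: measurable_history_law n intro!: g)
  also have "\<dots> = ?C ^ Suc n * (\<integral>\<^sup>+z. (f z)\<^sup>2 \<partial>history_law d \<sigma> \<theta> \<pi> (Suc n))"
    by (subst bind) (auto simp: mult_ac)
  finally show ?case .
qed

end

section \<open>Two-valued parameters and their stabilisers\<close>

text \<open>The values 1 and -1 give a vertex of the cube, a small multiple of it gives a hard
  parameter, and the values 0 and 1 give the indicators of the two blocks. Zero outside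
  \<open>{1..d}\<close> keeps the vector in \<open>euclidean d\<close>.\<close>

definition two_valued :: "nat \<Rightarrow> nat set \<Rightarrow> real \<Rightarrow> real \<Rightarrow> nat \<Rightarrow> real" where
  "two_valued d A a b = (\<lambda>i. if i \<in> {1..d} then if i \<in> A then a else b else 0)"

text \<open>For \<open>A\<close> inside \<open>{1..d}\<close> this is the Young subgroup of the
  partition into \<open>A\<close> and its complement.\<close>

definition block_group :: "nat \<Rightarrow> nat set \<Rightarrow> (nat \<Rightarrow> nat) set" where
  "block_group d A = {g. g permutes {1..d} \<and> (\<forall>i. g i \<in> A \<longleftrightarrow> i \<in> A)}"

lemma subgroup_block_group: "subgroup (block_group d A) (sym_group d)"
proof (rule group.subgroupI[OF sym_group_is_group])
  show "block_group d A \<subseteq> carrier (sym_group d)"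
    by (auto simp: block_group_def sym_group_carrier)
  have "id \<in> block_group d A"
    by (auto simp: block_group_def permutes_id)
  then show "block_group d A \<noteq> {}"
    by blast
next
  fix g assume g: "g \<in> block_group d A"
  then have p: "g permutes {1..d}"
    by (simp add: block_group_def)
  have "inv' g i \<in> A \<longleftrightarrow> i \<in> A" for i
  proof -
    have "g (inv' g i) \<in> A \<longleftrightarrow> inv' g i \<in> A"
      using g by (simp add: block_group_def)
    then show ?thesis
      by (simp add: permutes_inverses(1)[OF p])
  qed
  then show "inv\<^bsub>sym_group d\<^esub> g \<in> block_group d A"
    using p by (simp add: sym_group_inv_equality sym_group_carrier block_group_def permutes_inv)
next
  fix g h assume "g \<in> block_group d A" "h \<in> block_group d A"
  then show "g \<otimes>\<^bsub>sym_group d\<^esub> h \<in> block_group d A"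
    by (auto simp: block_group_def sym_group_mult permutes_compose)
qed

text \<open>The transposition of two indices of the same block belongs to the group, which forces a
  fixed vector to be constant on each block. Conversely, the group preserves both blocks.\<close>

lemma Fix_block_group:
  assumes "A \<subseteq> {1..d}"
  shows "Fix d (block_group d A) = {two_valued d A a b | a b. True}"
proof (intro equalityI subsetI)
  fix x assume x: "x \<in> Fix d (block_group d A)"
  have const: "x i = x j" if "i \<in> {1..d}" "j \<in> {1..d}" "i \<in> A \<longleftrightarrow> j \<in> A" for i j
  proof -
    have "Transposition.transpose i j \<in> block_group d A"
      using that permutes_swap_id[OF that(1,2)]
      by (simp add: block_group_def Transposition.transpose_def)
    with x have "perm_act (Transposition.transpose i j) x = x"
      by (auto simp: Fix_def)
    then have "perm_act (Transposition.transpose i j) x i = x i"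
      by (rule fun_cong)
    then show ?thesis by (simp add: perm_act_def)
  qed
  \<comment> \<open>For an empty block the choice is unspecified, which is harmless because no index
    then takes the corresponding value.\<close>
  define a where "a = x (SOME i. i \<in> A)"
  define b where "b = x (SOME i. i \<in> {1..d} - A)"
  have "x i = two_valued d A a b i" for i
  proof (cases "i \<in> {1..d}")
    case True
    show ?thesis
    proof (cases "i \<in> A")
      case in_A: True
      then have "(SOME i. i \<in> A) \<in> A"
        by (rule someI)
      with in_A True assms have "x i = a"
        unfolding a_def by (intro const) blast+
      with in_A True show ?thesis
        by (simp add: two_valued_def)
    next
      case not_in_A: False
      with True have "\<exists>i. i \<in> {1..d} - A"
        by blast
      then have "(SOME i. i \<in> {1..d} - A) \<in> {1..d} - A"
        by (rule someI_ex)
      with not_in_A True have "x i = b"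
        unfolding b_def by (intro const) blast+
      with not_in_A True show ?thesis
        by (simp add: two_valued_def)
    qed
  next
    case False
    with x show ?thesis
      by (auto simp: Fix_def euclidean_def two_valued_def)
  qed
  then have "x = two_valued d A a b"
    by (rule ext)
  then show "x \<in> {two_valued d A a b | a b. True}"
    by blast
next
  fix x assume "x \<in> {two_valued d A a b | a b. True}"
  then obtain a b where x: "x = two_valued d A a b"
    by blast
  have "perm_act g x = x" if "g \<in> block_group d A" for g
  proof -
    have "g i \<in> {1..d} \<longleftrightarrow> i \<in> {1..d}" "g i \<in> A \<longleftrightarrow> i \<in> A" for i
      using that permutes_in_image[of g "{1..d}" i] by (auto simp: block_group_def)
    then show ?thesis
      by (simp add: x perm_act_def two_valued_def fun_eq_iff)
  qed
  then show "x \<in> Fix d (block_group d A)"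
    by (auto simp: Fix_def euclidean_def x two_valued_def)
qed

text \<open>The indicators of the two blocks form a basis. Both blocks are nonempty, so an index of
  \<open>A\<close> separates the first indicator from the span of the second, and an index outside
  \<open>A\<close> shows that the second is nonzero.\<close>

lemma dim_Fix_block_group:
  assumes "A \<subset> {1..d}" "A \<noteq> {}"
  shows "fun_vs.dim (Fix d (block_group d A)) = 2"
proof -
  let ?u = "two_valued d A 1 0" and ?v = "two_valued d A 0 1"
  obtain i j where ij: "i \<in> A" "j \<in> {1..d} - A"
    using assms by blast
  have i: "i \<in> {1..d}"
    using ij assms by blast
  have ne: "?u \<noteq> ?v"
    using ij i by (auto simp: two_valued_def fun_eq_iff intro!: exI[of _ i])
  have comb: "two_valued d A a b = (\<lambda>i. a * ?u i) + (\<lambda>i. b * ?v i)" for a b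
    by (auto simp: two_valued_def fun_eq_iff)
  have span: "Fix d (block_group d A) \<subseteq> fun_vs.span {?u, ?v}"
  proof
    fix x assume "x \<in> Fix d (block_group d A)"
    then obtain a b where "x = two_valued d A a b"
      using assms by (auto simp: Fix_block_group)
    then have x: "x = (\<lambda>i. a * ?u i) + (\<lambda>i. b * ?v i)"
      using comb[of a b] by (rule trans)
    show "x \<in> fun_vs.span {?u, ?v}"
      unfolding x by (intro fun_vs.span_add fun_vs.span_scale fun_vs.span_base) auto
  qed
  have indep: "fun_vs.independent {?u, ?v}"
  proof (rule fun_vs.independent_insertI)
    show "?u \<notin> fun_vs.span {?v}"
    proof
      assume "?u \<in> fun_vs.span {?v}"
      then obtain k where "?u = (\<lambda>i. k * ?v i)"
        unfolding fun_vs.span_singleton by blast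
      then have "?u i = k * ?v i"
        by metis
      then show False
        using ij i by (simp add: two_valued_def)
    qed
    have "?v j \<noteq> 0"
      using ij by (simp add: two_valued_def)
    then have "?v \<noteq> 0"
      by (metis zero_fun_apply)
    then show "fun_vs.independent {?v}"
      by simp
  qed
  have sub: "{?u, ?v} \<subseteq> Fix d (block_group d A)"
    using assms by (auto simp: Fix_block_group)
  show ?thesis
    by (rule fun_vs.dim_unique[OF sub span indep]) (use ne in simp)
qed

text \<open>If \<open>S\<close> is empty or full, its own block group fixes only the line of
  constant vectors. The vector is then constant, and the block \<open>{1}\<close>, which is proper
  since \<open>d\<close> is at least 2, serves instead.\<close>

lemma two_valued_in_Fix:
  assumes "d \<ge> 2" "S \<subseteq> {1..d}"
  obtains G where "subgroup G (sym_group d)" "fun_vs.dim (Fix d G) = 2"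
    "two_valued d S a b \<in> Fix d G"
proof -
  have *: "\<exists>A a' b'. A \<subset> {1..d} \<and> A \<noteq> {} \<and> two_valued d S a b = two_valued d A a' b'"
  proof (cases "S = {} \<or> S = {1..d}")
    case True
    have "{1} \<subseteq> {1..d}" "2 \<in> {1..d}" "2 \<notin> {1::nat}"
      using assms(1) by simp_all
    then have one: "{1} \<subset> {1..d}"
      by blast
    have "two_valued d S a b = two_valued d {1} (if S = {} then b else a) (if S = {} then b else a)"
      using True by (auto simp: two_valued_def fun_eq_iff)
    with one show ?thesis by blast
  next
    case False
    with assms show ?thesis by blast
  qed
  then obtain A a' b' where A: "A \<subset> {1..d}" "A \<noteq> {}" "two_valued d S a b = two_valued d A a' b'"
    by blast
  show thesis
  proof (rule that[of "block_group d A"])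
    show "fun_vs.dim (Fix d (block_group d A)) = 2"
      by (rule dim_Fix_block_group[OF A(1,2)])
    show "two_valued d S a b \<in> Fix d (block_group d A)"
      using A by (auto simp: Fix_block_group)
  qed (rule subgroup_block_group)
qed

section \<open>Regret on the vertices of a cube of parameters\<close>

text \<open>Averaging over all subsets: for fixed \<open>i\<close>, toggling membership of
  \<open>i\<close> is an involution of \<open>Pow I\<close>, so the mean of \<open>r i S\<close> is
  at least \<open>c / 2\<close>. Some \<open>S\<close> is at least as good as the mean of the whole
  sum.\<close>

lemma exists_subset_sum_ge:
  fixes r :: "'a \<Rightarrow> 'a set \<Rightarrow> real"
  assumes fin: "finite I"
    and pair: "\<And>i S. i \<in> S \<Longrightarrow> S \<subseteq> I \<Longrightarrow> r i S + r i (S - {i}) \<ge> c"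
  shows "\<exists>S\<subseteq>I. (\<Sum>i\<in>I. r i S) \<ge> real (card I) * c / 2"
proof (rule ccontr)
  assume "\<not> ?thesis"
  then have "(\<Sum>S\<in>Pow I. \<Sum>i\<in>I. r i S) < (\<Sum>S\<in>Pow I. real (card I) * c / 2)"
    using fin by (intro sum_strict_mono) (auto simp: not_le)
  also have "\<dots> = (\<Sum>i\<in>I. 2 ^ card I * c / 2)"
    by (simp add: card_Pow fin)
  also have "\<dots> \<le> (\<Sum>i\<in>I. \<Sum>S\<in>Pow I. r i S)"
  proof (rule sum_mono)
    fix i assume i: "i \<in> I"
    define flip where "flip S = (if i \<in> S then S - {i} else insert i S)" for S
    have "2 ^ card I * c = (\<Sum>S\<in>Pow I. c)"
      by (simp add: card_Pow fin)
    also have "\<dots> \<le> (\<Sum>S\<in>Pow I. r i S + r i (flip S))"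
    proof (rule sum_mono)
      fix S assume S: "S \<in> Pow I"
      show "c \<le> r i S + r i (flip S)"
        using pair[of i S] pair[of i "insert i S"] i S by (cases "i \<in> S") (auto simp: flip_def)
    qed
    also have "\<dots> = 2 * (\<Sum>S\<in>Pow I. r i S)"
    proof -
      have "(\<Sum>S\<in>Pow I. r i (flip S)) = (\<Sum>S\<in>Pow I. r i S)"
        by (rule sum.reindex_bij_witness[of _ flip flip])
          (use i in \<open>auto simp: flip_def split: if_splits\<close>)
      then show ?thesis by (simp add: sum.distrib)
    qed
    finally show "2 ^ card I * c / 2 \<le> (\<Sum>S\<in>Pow I. r i S)" by simp
  qed
  also have "\<dots> = (\<Sum>S\<in>Pow I. \<Sum>i\<in>I. r i S)"
    by (rule sum.swap)
  finally show False by simp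
qed

text \<open>Either \<open>u\<close> is at least 1/2 and the quadratic bound makes \<open>w\<close>
  large, or \<open>1 - u\<close> exceeds 1/2 by itself. Here \<open>u\<close> and \<open>w\<close>
  will be the expected \<open>miss\<close> of one coordinate under the two signs of that
  coordinate.\<close>

lemma add_one_minus_ge_if_square_le:
  fixes u w C :: real
  assumes "u\<^sup>2 \<le> C * w" "C \<ge> 1" "0 \<le> w" "u \<le> 1"
  shows "w + (1 - u) \<ge> 1 / (4 * C)"
proof (cases "u \<ge> 1 / 2")
  case True
  have "(1 / 2)\<^sup>2 \<le> u\<^sup>2"
    by (rule power_mono[OF True]) simp
  also have "\<dots> \<le> C * w"
    by (rule assms(1))
  finally have "1 \<le> w * (4 * C)"
    by (simp add: power2_eq_square mult_ac)
  then have "1 / (4 * C) \<le> w"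
    using assms(2) by (subst pos_divide_le_eq) simp_all
  with assms show ?thesis by linarith
next
  case False
  have "1 / (4 * C) \<le> 1 / 4"
    using assms(2) by (intro divide_left_mono) simp_all
  with False assms show ?thesis by linarith
qed

section \<open>Regret as a sum over coordinates\<close>

lemma two_valued_in_arms:
  assumes "d \<ge> 1" "\<bar>a\<bar> \<le> 1" "\<bar>b\<bar> \<le> 1"
  shows "two_valued d S a b \<in> arms d"
proof -
  have "norm_inf d (two_valued d S a b) \<le> 1"
    unfolding norm_inf_def
  proof (rule Max.boundedI)
    show "(\<lambda>i. \<bar>two_valued d S a b i\<bar>) ` {1..d} \<noteq> {}"
      using assms(1) by simp
  qed (use assms(2,3) in \<open>auto simp: two_valued_def\<close>)
  then show ?thesis
    by (simp add: arms_def euclidean_def two_valued_def)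
qed

text \<open>On the cube each coordinate contributes at most \<epsilon>, and the sign vector
  \<open>?s\<close> attains this in all coordinates at once.\<close>

lemma dot_best_arm_two_valued:
  assumes "d \<ge> 1" "\<epsilon> > 0"
  shows "dot d (best_arm d (two_valued d S \<epsilon> (-\<epsilon>))) (two_valued d S \<epsilon> (-\<epsilon>)) = real d * \<epsilon>"
proof -
  let ?\<theta> = "two_valued d S \<epsilon> (-\<epsilon>)" and ?s = "two_valued d S 1 (-1)"
  have s: "dot d ?s ?\<theta> = real d * \<epsilon>"
  proof -
    have "dot d ?s ?\<theta> = (\<Sum>i\<in>{1..d}. \<epsilon>)"
      unfolding dot_def by (rule sum.cong) (auto simp: two_valued_def)
    then show ?thesis by simp
  qed
  have "dot d x ?\<theta> \<le> dot d ?s ?\<theta>" if x: "x \<in> arms d" for x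
  proof -
    have "dot d x ?\<theta> \<le> (\<Sum>i\<in>{1..d}. \<epsilon>)"
      unfolding dot_def
    proof (rule sum_mono)
      fix i assume i: "i \<in> {1..d}"
      have "x i * ?\<theta> i \<le> \<bar>x i\<bar> * \<bar>?\<theta> i\<bar>"
        by (metis abs_ge_self abs_mult)
      also have "\<dots> \<le> 1 * \<epsilon>"
        using arms_abs_le[OF x i] assms i by (intro mult_mono) (auto simp: two_valued_def)
      finally show "x i * ?\<theta> i \<le> \<epsilon>" by simp
    qed
    with s show ?thesis by simp
  qed
  then show ?thesis
    unfolding best_arm_def s[symmetric]
    by (intro arg_max_equality[of "\<lambda>x. x \<in> arms d" ?s "\<lambda>x. dot d x ?\<theta>"] two_valued_in_arms assms) auto
qed

text \<open>Half the average distance of the \<open>i\<close>-th coordinate of the arms from \<open>1\<close>; half its average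
  distance from \<open>-1\<close> is the complementary value \<open>1 - miss i T h\<close>.\<close>

definition miss :: "nat \<Rightarrow> nat \<Rightarrow> history \<Rightarrow> real" where
  "miss i T h = (\<Sum>t\<in>{1..T}. 1 - fst (h t) i) / (2 * real T)"

lemma miss_measurable [measurable]: "miss i T \<in> borel_measurable (history_space d T)"
  unfolding miss_def[abs_def]
  by (intro borel_measurable_divide borel_measurable_sum borel_measurable_diff
      measurable_compose[OF history_arm_measurable coordinate_measurable]) auto

lemma miss_bounds:
  assumes "h \<in> space (history_space d T)" "T \<ge> 1" "i \<in> {1..d}"
  shows "0 \<le> miss i T h" "miss i T h \<le> 1"
proof -
  have *: "\<bar>fst (h t) i\<bar> \<le> 1" if "t \<in> {1..T}" for t
    using arms_abs_le history_arm_in_arms[OF assms(1) that] assms(3) by blast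
  show "0 \<le> miss i T h"
    unfolding miss_def using * by (intro divide_nonneg_nonneg sum_nonneg) (auto simp: abs_le_iff)
  have "(\<Sum>t\<in>{1..T}. 1 - fst (h t) i) \<le> (\<Sum>t\<in>{1..T}. 2)"
    using * by (intro sum_mono) (force simp: abs_le_iff)
  then show "miss i T h \<le> 1"
    unfolding miss_def using assms(2) by (simp add: divide_simps)
qed

text \<open>The cube is a product and the reward is linear, so the loss splits: in each round
  coordinate \<open>i\<close> costs \<epsilon> times the distance of the played coordinate from the
  sign of \<theta> there.\<close>

lemma sum_dot_best_arm_diff:
  fixes S :: "nat set"
  assumes "d \<ge> 1" "T \<ge> 1" "\<epsilon> > 0"
  defines "\<theta> \<equiv> two_valued d S \<epsilon> (-\<epsilon>)"
  shows "(\<Sum>t\<in>{1..T}. dot d (best_arm d \<theta> - fst (h t)) \<theta>)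
           = 2 * real T * \<epsilon> * (\<Sum>i\<in>{1..d}. if i \<in> S then miss i T h else 1 - miss i T h)"
proof -
  have "dot d (best_arm d \<theta> - x) \<theta> = (\<Sum>i\<in>{1..d}. \<epsilon> * (if i \<in> S then 1 - x i else 1 + x i))" for x
  proof -
    have "dot d (best_arm d \<theta> - x) \<theta> = dot d (best_arm d \<theta>) \<theta> - dot d x \<theta>"
      by (simp add: dot_def left_diff_distrib sum_subtractf)
    also have "\<dots> = (\<Sum>i\<in>{1..d}. \<epsilon>) - (\<Sum>i\<in>{1..d}. x i * \<theta> i)"
      using dot_best_arm_two_valued[OF assms(1,3)] by (simp add: \<theta>_def dot_def)
    also have "\<dots> = (\<Sum>i\<in>{1..d}. \<epsilon> - x i * \<theta> i)"
      by (rule sum_subtractf[symmetric])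
    also have "\<dots> = (\<Sum>i\<in>{1..d}. \<epsilon> * (if i \<in> S then 1 - x i else 1 + x i))"
      by (rule sum.cong) (auto simp: \<theta>_def two_valued_def algebra_simps)
    finally show ?thesis .
  qed
  then have "(\<Sum>t\<in>{1..T}. dot d (best_arm d \<theta> - fst (h t)) \<theta>)
      = (\<Sum>i\<in>{1..d}. \<Sum>t\<in>{1..T}. \<epsilon> * (if i \<in> S then 1 - fst (h t) i else 1 + fst (h t) i))"
    by (simp only:) (rule sum.swap)
  also have "\<dots> = (\<Sum>i\<in>{1..d}. 2 * real T * \<epsilon> * (if i \<in> S then miss i T h else 1 - miss i T h))"
  proof (rule sum.cong)
    fix i
    show "(\<Sum>t\<in>{1..T}. \<epsilon> * (if i \<in> S then 1 - fst (h t) i else 1 + fst (h t) i))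
        = 2 * real T * \<epsilon> * (if i \<in> S then miss i T h else 1 - miss i T h)"
      using assms(2)
      by (auto simp: miss_def sum_distrib_left[symmetric] sum.distrib sum_subtractf field_simps)
  qed simp
  finally show ?thesis by (simp add: sum_distrib_left)
qed

section \<open>Two-point bound for each coordinate and choice of the vertex\<close>

context
  fixes d T :: nat and \<sigma> :: real and \<pi> :: "nat \<Rightarrow> history \<Rightarrow> (nat \<Rightarrow> real) measure"
  assumes sigma: "\<sigma> > 0" and bandit: "bandit_algorithm d T \<pi>" and T: "T \<ge> 1"
begin

lemma miss_integrable:
  assumes "i \<in> {1..d}"
  shows "integrable (history_law d \<sigma> \<theta> \<pi> T) (miss i T)"
proof -
  interpret prob_space "history_law d \<sigma> \<theta> \<pi> T"
    by (rule prob_space_history_law[OF sigma bandit order_refl])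
  show ?thesis
    using miss_bounds[OF _ T assms]
    by (intro integrable_const_bound[of _ 1] AE_I2)
      (auto simp: space_history_law[OF sigma bandit] measurable_history_law[OF sigma bandit])
qed

lemma expected_miss_bounds:
  assumes "i \<in> {1..d}"
  shows "0 \<le> (\<integral>h. miss i T h \<partial>history_law d \<sigma> \<theta> \<pi> T)"
    "(\<integral>h. miss i T h \<partial>history_law d \<sigma> \<theta> \<pi> T) \<le> 1"
proof -
  interpret prob_space "history_law d \<sigma> \<theta> \<pi> T"
    by (rule prob_space_history_law[OF sigma bandit order_refl])
  have b: "0 \<le> miss i T h" "miss i T h \<le> 1" if "h \<in> space (history_law d \<sigma> \<theta> \<pi> T)" for h
    using miss_bounds[OF _ T assms] that by (auto simp: space_history_law[OF sigma bandit])
  show "0 \<le> (\<integral>h. miss i T h \<partial>history_law d \<sigma> \<theta> \<pi> T)"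
    by (intro Bochner_Integration.integral_nonneg b)
  show "(\<integral>h. miss i T h \<partial>history_law d \<sigma> \<theta> \<pi> T) \<le> 1"
    by (intro integral_le_const miss_integrable assms AE_I2 b)
qed

text \<open>Removing \<open>i\<close> from \<open>S\<close> changes one entry of the parameter from
  \<epsilon> to -\<epsilon>, so mean rewards move by at most \<open>2 * \<epsilon>\<close> on the
  cube and the comparison of history laws applies to \<open>miss\<close>.\<close>

lemma expected_miss_square_le:
  assumes "i \<in> S" "S \<subseteq> {1..d}" "\<epsilon> > 0"
  defines "\<theta> \<equiv> \<lambda>S. two_valued d S \<epsilon> (-\<epsilon>)"
  shows "(\<integral>h. miss i T h \<partial>history_law d \<sigma> (\<theta> (S - {i})) \<pi> T)\<^sup>2
           \<le> exp ((2 * \<epsilon>)\<^sup>2 / \<sigma>\<^sup>2) ^ T * (\<integral>h. miss i T h \<partial>history_law d \<sigma> (\<theta> S) \<pi> T)"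
    (is "?u\<^sup>2 \<le> ?C ^ T * ?w")
proof -
  have i: "i \<in> {1..d}"
    using assms by blast
  have close: "\<bar>dot d x (\<theta> (S - {i})) - dot d x (\<theta> S)\<bar> \<le> 2 * \<epsilon>" if x: "x \<in> arms d" for x
  proof -
    have "dot d x (\<theta> (S - {i})) - dot d x (\<theta> S)
        = (\<Sum>j\<in>{1..d}. x j * \<theta> (S - {i}) j - x j * \<theta> S j)"
      by (simp add: dot_def sum_subtractf)
    also have "\<dots> = (\<Sum>j\<in>{1..d}. if j = i then - 2 * \<epsilon> * x i else 0)"
      by (rule sum.cong) (use assms(1) in \<open>auto simp: \<theta>_def two_valued_def\<close>)
    also have "\<dots> = - 2 * \<epsilon> * x i"
      using i by simp
    finally show ?thesis
      using arms_abs_le[OF x i] assms(3) by (simp add: abs_mult)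
  qed
  have nn: "(\<integral>\<^sup>+h. ennreal (miss i T h) \<partial>history_law d \<sigma> \<theta>' \<pi> T)
      = ennreal (\<integral>h. miss i T h \<partial>history_law d \<sigma> \<theta>' \<pi> T)" for \<theta>'
    by (intro nn_integral_eq_integral miss_integrable i AE_I2)
      (use miss_bounds[OF _ T i] in \<open>auto simp: space_history_law[OF sigma bandit]\<close>)
  have "(ennreal ?u)\<^sup>2
      \<le> ennreal ?C ^ T * (\<integral>\<^sup>+h. (ennreal (miss i T h))\<^sup>2 \<partial>history_law d \<sigma> (\<theta> S) \<pi> T)"
    unfolding nn[symmetric]
    by (rule history_law_square_le[OF sigma bandit close]) auto
  \<comment> \<open>As \<open>miss\<close> lies between 0 and 1, its second moment is at most its
    mean.\<close>
  also have "\<dots> \<le> ennreal ?C ^ T * (\<integral>\<^sup>+h. ennreal (miss i T h) \<partial>history_law d \<sigma> (\<theta> S) \<pi> T)"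
  proof (intro mult_left_mono nn_integral_mono)
    fix h assume "h \<in> space (history_law d \<sigma> (\<theta> S) \<pi> T)"
    then have "h \<in> space (history_space d T)"
      by (simp add: space_history_law[OF sigma bandit])
    from miss_bounds[OF this T i] show "(ennreal (miss i T h))\<^sup>2 \<le> ennreal (miss i T h)"
      by (simp add: ennreal_power power2_eq_square mult_left_le)
  qed simp
  finally show ?thesis
    unfolding nn
    using expected_miss_bounds(1)[OF i]
    by (simp add: ennreal_power ennreal_mult[symmetric] ennreal_le_iff)
qed

lemma regret_two_valued:
  fixes S :: "nat set"
  assumes "d \<ge> 1" "\<epsilon> > 0"
  defines "\<theta> \<equiv> two_valued d S \<epsilon> (-\<epsilon>)"
  shows "regret d \<sigma> \<theta> \<pi> T = 2 * real T * \<epsilon> *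
    (\<Sum>i\<in>{1..d}. if i \<in> S then \<integral>h. miss i T h \<partial>history_law d \<sigma> \<theta> \<pi> T
                 else 1 - (\<integral>h. miss i T h \<partial>history_law d \<sigma> \<theta> \<pi> T))"
proof -
  interpret prob_space "history_law d \<sigma> \<theta> \<pi> T"
    by (rule prob_space_history_law[OF sigma bandit order_refl])
  have "regret d \<sigma> \<theta> \<pi> T = (\<integral>h. 2 * real T * \<epsilon> *
      (\<Sum>i\<in>{1..d}. if i \<in> S then miss i T h else 1 - miss i T h) \<partial>history_law d \<sigma> \<theta> \<pi> T)"
    unfolding regret_def \<theta>_def sum_dot_best_arm_diff[OF assms(1) T assms(2)] ..
  also have "\<dots> = 2 * real T * \<epsilon> * (\<Sum>i\<in>{1..d}.
      \<integral>h. (if i \<in> S then miss i T h else 1 - miss i T h) \<partial>history_law d \<sigma> \<theta> \<pi> T)"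
  proof -
    have "integrable (history_law d \<sigma> \<theta> \<pi> T) (\<lambda>h. if i \<in> S then miss i T h else 1 - miss i T h)"
      if "i \<in> {1..d}" for i
      using miss_integrable[OF that] by (cases "i \<in> S") auto
    then show ?thesis by simp
  qed
  also have "(\<Sum>i\<in>{1..d}.
      \<integral>h. (if i \<in> S then miss i T h else 1 - miss i T h) \<partial>history_law d \<sigma> \<theta> \<pi> T)
    = (\<Sum>i\<in>{1..d}. if i \<in> S then \<integral>h. miss i T h \<partial>history_law d \<sigma> \<theta> \<pi> T
                 else 1 - (\<integral>h. miss i T h \<partial>history_law d \<sigma> \<theta> \<pi> T))"
    by (rule sum.cong) (auto simp: miss_integrable prob_space)
  finally show ?thesis .
qed

lemma exists_two_valued_regret_ge:
  assumes "d \<ge> 1"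
  shows "\<exists>S\<subseteq>{1..d}. \<exists>\<epsilon>. regret d \<sigma> (two_valued d S \<epsilon> (-\<epsilon>)) \<pi> T
           \<ge> \<sigma> / (8 * exp 1) * real d * sqrt (real T)"
proof -
  \<comment> \<open>Chosen so that \<open>T\<close> rounds, each with exponent
    \<open>(2 * \<epsilon>)^2 / \<sigma>^2 = 1 / T\<close>, accumulate exactly the factor
    \<open>exp 1\<close>.\<close>
  define \<epsilon> where "\<epsilon> = \<sigma> / (2 * sqrt (real T))"
  have eps: "\<epsilon> > 0"
    using sigma T by (simp add: \<epsilon>_def)
  have C: "exp ((2 * \<epsilon>)\<^sup>2 / \<sigma>\<^sup>2) ^ T = exp 1"
    using sigma T by (simp add: \<epsilon>_def power_divide power_mult_distrib exp_of_nat_mult[symmetric])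
  define a where
    "a i S = (\<integral>h. miss i T h \<partial>history_law d \<sigma> (two_valued d S \<epsilon> (-\<epsilon>)) \<pi> T)" for i S
  define r where "r i S = (if i \<in> S then a i S else 1 - a i S)" for i S
  \<comment> \<open>Since \<open>i\<close> is not in \<open>S - {i}\<close>, the second term is
    \<open>1 - a i (S - {i})\<close>, so the elementary dichotomy applies with
    \<open>C = exp 1\<close>.\<close>
  have "r i S + r i (S - {i}) \<ge> 1 / (4 * exp 1)" if "i \<in> S" "S \<subseteq> {1..d}" for i S
  proof -
    have i: "i \<in> {1..d}"
      using that by blast
    have "(a i (S - {i}))\<^sup>2 \<le> exp 1 * a i S"
      using expected_miss_square_le[OF that eps] unfolding C a_def .
    then show ?thesis
      using add_one_minus_ge_if_square_le[of "a i (S - {i})" "exp 1" "a i S"]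
        expected_miss_bounds[OF i] that by (simp add: r_def a_def)
  qed
  then obtain S where S: "S \<subseteq> {1..d}"
    and sum: "(\<Sum>i\<in>{1..d}. r i S) \<ge> real (card {1..d}) * (1 / (4 * exp 1)) / 2"
    using exists_subset_sum_ge[of "{1..d}" "1 / (4 * exp 1)" r] by auto
  have "sqrt (real T) * sqrt (real T) = real T"
    by simp
  then have scale: "2 * real T * \<epsilon> = \<sigma> * sqrt (real T)"
    using T by (simp add: \<epsilon>_def field_simps)
  have "regret d \<sigma> (two_valued d S \<epsilon> (-\<epsilon>)) \<pi> T = \<sigma> * sqrt (real T) * (\<Sum>i\<in>{1..d}. r i S)"
    unfolding scale[symmetric] r_def a_def by (rule regret_two_valued[OF assms eps])
  \<comment> \<open>The 4 comes from the dichotomy and the further 2 from averaging over a pair of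
    signs, which gives the 8 in the final constant.\<close>
  also have "\<dots> \<ge> \<sigma> * sqrt (real T) * (real (card {1..d}) * (1 / (4 * exp 1)) / 2)"
    using sum sigma by (intro mult_left_mono) auto
  finally show ?thesis
    using S by (auto simp: mult_ac intro!: exI[of _ S] exI[of _ \<epsilon>])
qed

end

theorem proposition3:
  fixes \<sigma> :: real
  assumes "\<sigma> > 0"
  shows "\<exists>c>0. \<forall>d\<ge>2. \<forall>T\<ge>1. \<forall>\<pi>. bandit_algorithm d T \<pi> \<longrightarrow>
           (\<exists>G \<theta>. subgroup G (sym_group d) \<and> fun_vs.dim (Fix d G) = 2 \<and> \<theta> \<in> Fix d G \<and>
                  regret d \<sigma> \<theta> \<pi> T \<ge> c * real d * sqrt (real T))"
proof (intro exI[of _ "\<sigma> / (8 * exp 1)"] conjI allI impI)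
  show "\<sigma> / (8 * exp 1) > 0"
    using assms by simp
next
  fix d T :: nat and \<pi> :: "nat \<Rightarrow> history \<Rightarrow> (nat \<Rightarrow> real) measure"
  assume d: "2 \<le> d" and T: "1 \<le> T" and bandit: "bandit_algorithm d T \<pi>"
  have "1 \<le> d"
    using d by simp
  from exists_two_valued_regret_ge[OF assms bandit T this] obtain S \<epsilon> where S: "S \<subseteq> {1..d}"
    and regret: "\<sigma> / (8 * exp 1) * real d * sqrt (real T) \<le> regret d \<sigma> (two_valued d S \<epsilon> (-\<epsilon>)) \<pi> T"
    by blast
  \<comment> \<open>The group is read off from the bad vertex, so it may depend on the algorithm, as
    the order of quantifiers allows.\<close>
  from two_valued_in_Fix[OF d S, of \<epsilon> "-\<epsilon>"] obtain G where "subgroup G (sym_group d)"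
    "fun_vs.dim (Fix d G) = 2" "two_valued d S \<epsilon> (-\<epsilon>) \<in> Fix d G"
    by blast
  with regret show "\<exists>G \<theta>. subgroup G (sym_group d) \<and> fun_vs.dim (Fix d G) = 2 \<and> \<theta> \<in> Fix d G \<and>
      \<sigma> / (8 * exp 1) * real d * sqrt (real T) \<le> regret d \<sigma> \<theta> \<pi> T"
    by blast
qed

end
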